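(* Consider the $\hat H_q$-module $\mathbf W$ on which, for $n\in\{0,1,2,3\}$, the generator $t_n$ is represented by the matrix $\mathcal T_n$ relative to the basis $\mathcal C$ (as defined in the context). The $\hat H_q$-module $\mathbf W$ is irreducible.
   Context: **Graph.** $\Gamma$ is a finite undirected connected graph without loops or multiple edges, with vertex set $X$, path-length distance $\partial$ and diameter $d\ge 3$; $\Gamma_i(y)=\{z\in X:\partial(y,z)=i\}$, $\Gamma(y)=\Gamma_1(y)$. $\Gamma$ is distance-regular: $p^h_{ij}=|\Gamma_i(y)\cap\Gamma_j(z)|$ depends only on $i,j$ and $h=\partial(y,z)$. Put $a_i=p^i_{1,i}$, $b_i=p^i_{1,i+1}$, $c_i=p^i_{1,i-1}$ ($b_d=c_0=0$), $k=b_0$. Complex matrices indexed by $X$ act on $\mathbf V=\mathbb C^X$ with inner product $\langle u,v\rangle=u^t\overline v$; $\hat y$ is the standard basis vector at $y$, $\hat Y=\sum_{y\in Y}\hat y$, $\mathbf j=\hat X$. $A_i$ is the $i$-th distance matrix, $A=A_1$, $\mathcal M$ is the algebra generated by $A$ (Bose–Mesner algebra), with primitive idempotents $E_0=|X|^{-1}J,E_1,\dots,E_d$ ($J$ all-ones) and $A=\sum_i\theta_iE_i$; $m_i=\operatorname{rank}E_i$. $\Gamma$ is $Q$-polynomial with respect to $E_0,\dots,E_d$: writing $E_i\circ E_j=|X|^{-1}\sum_h q^h_{ij}E_h$ (entrywise product), $q^h_{ij}=0$ (resp. $\ne0$) if one of $h,i,j$ is greater than (resp. equal to) the sum of the other two.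 It is assumed that $\theta_0>\theta_1>\dots>\theta_d$. **Clique.** $C\subseteq X$ is a Delsarte clique: a nonempty set of mutually adjacent vertices with $|C|=1-k/\theta_d$. Fix $x\in C$. $A^*=A^*(x)$ is the diagonal matrix with $(z,z)$-entry $|X|(E_1)_{xz}$; $E^*_i$ ($0\le i\le d$) is the diagonal projection onto $\mathrm{Span}\{\hat z:\partial(x,z)=i\}$, and $A^*=\sum_i\theta^*_iE^*_i$. For $0\le i\le d-1$, $C_i=\{y\in X:\partial(y,C)=i\}$ (these partition $X$). **Leonard systems.** On a complex vector space $V$ of dimension $n+1$, a Leonard system of diameter $n$ is a sequence $(B;B^*;\{F_i\}_{i=0}^n;\{F^*_i\}_{i=0}^n)$ where $B,B^*\in\mathrm{End}(V)$ each have $n+1$ distinct eigenvalues, $\{F_i\}$ (resp. $\{F_i^*\}$) is an ordering of the primitive idempotents (spectral projections) of $B$ (resp. $B^*$), and $F_iB^*F_j$, $F^*_iBF^*_j$ are $0$ if $|i-j|>1$ and nonzero if $|i-j|=1$. Eigenvalues $\vartheta_i$, dual eigenvalues $\vartheta^*_i$ are defined by $BF_i=\vartheta_iF_i$, $B^*F_i^*=\vartheta_i^*F_i^*$. The first split sequence is the sequence of nonzero scalars $\varphi_1,\dots,\varphi_n$ such that in some basis $B$ is lower bidiagonal with diagonal $\vartheta_0,\dots,\vartheta_n$ and subdiagonal entries $1$, and $B^*$ is upper bidiagonal with diagonal $\vartheta^*_0,\dots,\vartheta_n^*$ and superdiagonal $\varphi_1,\dots,\varphi_n$. The second split sequence $\{\phi_i\}$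 is the first split sequence of $(B;B^*;\{F_{n-i}\};\{F^*_i\})$. The parameter array is $(\{\vartheta_i\},\{\vartheta_i^*\},\{\varphi_i\},\{\phi_i\})$. **$q$-Racah assumption.** $q\in\mathbb C$ is nonzero, $q^2\neq1$. $(A;A^*;\{E_i\}_{i=0}^d;\{E_i^*\}_{i=0}^d)$ acts on $\mathcal M\hat x$ (of dimension $d+1$) as a Leonard system $\Phi$ with parameter array $(\{\theta_i\},\{\theta^*_i\},\{\varphi_i\},\{\phi_i\})$. $\Gamma$ is assumed to have $q$-Racah type: there are nonzero $h,h^*,s,s^*,r_1,r_2\in\mathbb C$ (fixed) with $r_1r_2=ss^*q^{d+1}$, none of $q^i,r_1q^i,r_2q^i,s^*q^i/r_1,s^*q^i/r_2$ equal to $1$ for $1\le i\le d$, neither of $sq^i,s^*q^i$ equal to $1$ for $2\le i\le 2d$, and $\theta_i=\theta_0+h(1-q^i)(1-sq^{i+1})q^{-i}$, $\theta^*_i=\theta^*_0+h^*(1-q^i)(1-s^*q^{i+1})q^{-i}$ ($0\le i\le d$), $\varphi_i=hh^*q^{1-2i}(1-q^i)(1-q^{i-d-1})(1-r_1q^i)(1-r_2q^i)$, $\phi_i=hh^*q^{1-2i}(1-q^i)(1-q^{i-d-1})(r_1-s^*q^i)(r_2-s^*q^i)/s^*$ ($1\le i\le d$). **The space $\mathbf W$.** For $0\le i\le d-1$, $C_i^-=C_i\cap\Gamma_i(x)$, $C_i^+=C_i\cap\Gamma_{i+1}(x)$; $\mathbf W=\mathrm{Span}\{\hat C_i^{\pm}\}_{i=0}^{d-1}$,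 which has basis $\mathcal C=\{\hat C_0^-,\hat C_0^+,\hat C_1^-,\hat C_1^+,\dots,\hat C_{d-1}^-,\hat C_{d-1}^+\}$ (in this order). **The algebra and its action.** Fix a square root $q^{1/2}$ of $q$ and square roots $s^{1/2},s^{*1/2},r_1^{1/2},r_2^{1/2}$ with $r_1^{1/2}r_2^{1/2}=s^{1/2}s^{*1/2}q^{(d+1)/2}$. $\hat H_q$ is the $\mathbb C$-algebra with generators $t_n^{\pm1}$ ($n=0,1,2,3$) and relations $t_nt_n^{-1}=t_n^{-1}t_n=1$; $t_n+t_n^{-1}$ central; $t_0t_1t_2t_3=q^{-1/2}$. Put $\sigma=s^{*1/2}$, $\rho=r_1^{1/2}r_2^{1/2}$, $\kappa=s^{*1/2}q^{(d+1)/2}$. For $0\le i\le d-1$ let $P_i=\frac{(r_1-s^*q^{i+1})(r_2-s^*q^{i+1})}{1-s^*q^{2i+2}}$, $R_i=\frac{(1-r_1q^{i+1})(1-r_2q^{i+1})}{1-s^*q^{2i+2}}$, and for $1\le i\le d-1$ let $U_i=\frac{(1-q^{i-d})(1-s^*q^{i+1})}{1-s^*q^{2i+1}}$, $V_i=\frac{(1-q^i)(1-s^*q^{d+i+1})}{1-s^*q^{2i+1}}$, $Z_i=\frac{(1-q^i)(1-q^{i-d})}{1-s^*q^{2i+1}}$. Define $$\mathfrak t_0(i)=\begin{bmatrix}\frac{P_i+s^*}{\sigma\rho}&-\frac{\sigma}{\rho}R_i\\ \frac{P_i}{\sigma\rho}&\frac{\sigma}{\rho}(1-R_i)\end{bmatrix},\quad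 \mathfrak t_3(i)=\begin{bmatrix}\frac{1-R_i}{q^{i+1}\rho}&\frac{R_i}{q^{i+1}\rho}\\ -\frac{q^{i+1}}{\rho}P_i&\frac{q^{i+1}}{\rho}(P_i+s^* )\end{bmatrix}\quad(0\le i\le d-1),$$ $$\mathfrak t_1(i)=\begin{bmatrix}q^{d/2}U_i+q^{-d/2}&-q^{d/2}U_i\\ q^{-d/2}V_i&q^{-d/2}(1-V_i)\end{bmatrix},\quad \mathfrak t_2(i)=\begin{bmatrix}\frac{\kappa^2Z_i+1}{\kappa}&q^i\kappa U_i\\ -\frac{V_i}{q^i\kappa}&\kappa(1-Z_i)\end{bmatrix}\quad(1\le i\le d-1),$$ and $1\times1$ matrices $\mathfrak t_1(0)=\mathfrak t_1(d)=[q^{-d/2}]$, $\mathfrak t_2(0)=[\kappa]$, $\mathfrak t_2(d)=[\kappa^{-1}]$. For $n\in\{0,3\}$, $\mathcal T_n=\mathrm{blockdiag}[\mathfrak t_n(0),\dots,\mathfrak t_n(d-1)]$; for $n\in\{1,2\}$, $\mathcal T_n=\mathrm{blockdiag}[\mathfrak t_n(0),\mathfrak t_n(1),\dots,\mathfrak t_n(d)]$. A matrix $N$ represents a map $f$ relative to an ordered basis $w_1,\dots,w_{2d}$ when $f(w_j)=\sum_iN_{ij}w_i$. There is an $\hat H_q$-module structure on $\mathbf W$ in which $t_n$ is represented by $\mathcal T_n$ relative to $\mathcal C$. *)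

theory Defs
  imports
    "Jordan_Normal_Form.Matrix"
    "HOL-Algebra.QuotRing"
    "HOL-Library.Poly_Mapping"
    "HOL-Analysis.Analysis"
begin

text \<open>
  Vectors and matrices indexed by the vertex set use the types of HOL-Analysis
  (\<open>complex ^ 'x\<close>, \<open>complex ^ 'x ^ 'x\<close>, complex subspaces via \<open>vec.subspace\<close>, \<open>vec.span\<close>).
  Matrices indexed by positions in an ordered basis are matrices of the AFP entry
  \<open>Jordan_Normal_Form\<close> (type \<open>complex mat\<close>, entries \<open>N $$ (i, j)\<close>, counted from 0).
\<close>

hide_const (open) Matrix.mat Matrix.vec
no_notation Matrix.vec_index (infixl "$" 100)


section \<open>Distance-regular graphs\<close>

text \<open>The vertex set is the whole (finite, nonempty) type \<open>'x\<close>.\<close>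

definition connected_simple_graph :: "('x::finite \<Rightarrow> 'x \<Rightarrow> bool) \<Rightarrow> bool" where
  "connected_simple_graph adj \<longleftrightarrow>
     (\<forall>y z. adj y z \<longrightarrow> adj z y) \<and> (\<forall>y. \<not> adj y y) \<and> (\<forall>y z. adj\<^sup>*\<^sup>* y z)"

definition gdist :: "('x \<Rightarrow> 'x \<Rightarrow> bool) \<Rightarrow> 'x \<Rightarrow> 'x \<Rightarrow> nat" where
  "gdist adj y z = (LEAST n. (adj ^^ n) y z)"

definition graph_diameter :: "('x::finite \<Rightarrow> 'x \<Rightarrow> bool) \<Rightarrow> nat" where
  "graph_diameter adj = Max {gdist adj y z | y z. True}"

definition sphere_at :: "('x \<Rightarrow> 'x \<Rightarrow> bool) \<Rightarrow> nat \<Rightarrow> 'x \<Rightarrow> 'x set" where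
  "sphere_at adj i y = {z. gdist adj y z = i}"

definition distance_regular :: "('x::finite \<Rightarrow> 'x \<Rightarrow> bool) \<Rightarrow> bool" where
  "distance_regular adj \<longleftrightarrow>
     (\<forall>i j y z y' z'. gdist adj y z = gdist adj y' z' \<longrightarrow>
        card (sphere_at adj i y \<inter> sphere_at adj j z) =
        card (sphere_at adj i y' \<inter> sphere_at adj j z'))"

text \<open>\<open>intersection_number adj h i j\<close> is \<open>p\<^sup>h\<^sub>i\<^sub>j\<close>.\<close>

definition intersection_number :: "('x::finite \<Rightarrow> 'x \<Rightarrow> bool) \<Rightarrow> nat \<Rightarrow> nat \<Rightarrow> nat \<Rightarrow> nat" where
  "intersection_number adj h i j =
     (THE n. \<forall>y z. gdist adj y z = h \<longrightarrow> card (sphere_at adj i y \<inter> sphere_at adj j z) = n)"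

text \<open>\<open>k = b\<^sub>0 = p\<^sup>0\<^sub>1\<^sub>1\<close>.\<close>

definition valency :: "('x::finite \<Rightarrow> 'x \<Rightarrow> bool) \<Rightarrow> nat" where
  "valency adj = intersection_number adj 0 1 1"


section \<open>Bose-Mesner algebra and the Q-polynomial property\<close>

definition char_vec :: "'x set \<Rightarrow> complex ^ 'x::finite" where
  "char_vec Y = (\<chi> z. if z \<in> Y then 1 else 0)"

definition mscale :: "complex \<Rightarrow> complex ^ 'x ^ 'x \<Rightarrow> complex ^ 'x ^ 'x::finite" where
  "mscale c M = (\<chi> y z. c * M $ y $ z)"

definition entrywise_product ::
    "complex ^ 'x ^ 'x \<Rightarrow> complex ^ 'x ^ 'x \<Rightarrow> complex ^ 'x ^ 'x::finite" where
  "entrywise_product M N = (\<chi> y z. M $ y $ z * N $ y $ z)"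

definition all_ones :: "complex ^ 'x ^ 'x::finite" where
  "all_ones = (\<chi> y z. 1)"

definition distance_matrix :: "('x \<Rightarrow> 'x \<Rightarrow> bool) \<Rightarrow> nat \<Rightarrow> complex ^ 'x ^ 'x::finite" where
  "distance_matrix adj i = (\<chi> y z. if gdist adj y z = i then 1 else 0)"

abbreviation adjacency_matrix :: "('x \<Rightarrow> 'x \<Rightarrow> bool) \<Rightarrow> complex ^ 'x ^ 'x::finite" where
  "adjacency_matrix adj \<equiv> distance_matrix adj 1"

inductive_set generated_algebra :: "complex ^ 'x ^ 'x \<Rightarrow> (complex ^ 'x ^ 'x::finite) set"
  for B where
  one: "mat 1 \<in> generated_algebra B"
| gen: "B \<in> generated_algebra B"
| add: "M \<in> generated_algebra B \<Longrightarrow> N \<in> generated_algebra B \<Longrightarrow> M + N \<in> generated_algebra B"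
| scale: "M \<in> generated_algebra B \<Longrightarrow> mscale c M \<in> generated_algebra B"
| mult: "M \<in> generated_algebra B \<Longrightarrow> N \<in> generated_algebra B \<Longrightarrow> M ** N \<in> generated_algebra B"

definition bose_mesner :: "('x \<Rightarrow> 'x \<Rightarrow> bool) \<Rightarrow> (complex ^ 'x ^ 'x::finite) set" where
  "bose_mesner adj = generated_algebra (adjacency_matrix adj)"

definition primitive_idempotents :: "(complex ^ 'x ^ 'x) set \<Rightarrow> (complex ^ 'x ^ 'x::finite) set" where
  "primitive_idempotents \<M> =
     {e \<in> \<M>. e \<noteq> 0 \<and> e ** e = e \<and>
        (\<forall>f\<in>\<M>. \<forall>g\<in>\<M>. f ** f = f \<longrightarrow> g ** g = g \<longrightarrow> f ** g = 0 \<longrightarrow> g ** f = 0 \<longrightarrow>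
           e = f + g \<longrightarrow> f = 0 \<or> g = 0)}"

text \<open>
  The sequence \<open>E 0, \<dots>, E d\<close> is an ordering of the primitive idempotents of the Bose-Mesner
  algebra with \<open>E 0 = |X|\<^sup>-\<^sup>1 J\<close>, and \<open>\<Gamma>\<close> is Q-polynomial with respect to it; \<open>krein h i j\<close> is
  the Krein parameter \<open>q\<^sup>h\<^sub>i\<^sub>j\<close>.
\<close>

definition Q_polynomial ::
    "('x \<Rightarrow> 'x \<Rightarrow> bool) \<Rightarrow> nat \<Rightarrow> (nat \<Rightarrow> complex ^ 'x ^ 'x::finite) \<Rightarrow> bool" where
  "Q_polynomial adj d E \<longleftrightarrow>
     bij_betw E {0..d} (primitive_idempotents (bose_mesner adj)) \<and>
     E 0 = mscale (1 / of_nat CARD('x)) all_ones \<and>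
     (\<exists>krein :: nat \<Rightarrow> nat \<Rightarrow> nat \<Rightarrow> complex.
        (\<forall>i\<le>d. \<forall>j\<le>d. entrywise_product (E i) (E j) =
            mscale (1 / of_nat CARD('x)) (\<Sum>h\<le>d. mscale (krein h i j) (E h))) \<and>
        (\<forall>h\<le>d. \<forall>i\<le>d. \<forall>j\<le>d.
            (h > i + j \<or> i > h + j \<or> j > h + i \<longrightarrow> krein h i j = 0) \<and>
            (h = i + j \<or> i = h + j \<or> j = h + i \<longrightarrow> krein h i j \<noteq> 0)))"

text \<open>The matrices \<open>A\<^sup>*(x)\<close> and \<open>E\<^sup>*\<^sub>i(x)\<close>, and the subspace \<open>\<M>x\<close>.\<close>

definition dual_adjacency_matrix ::
    "(nat \<Rightarrow> complex ^ 'x ^ 'x) \<Rightarrow> 'x \<Rightarrow> complex ^ 'x ^ 'x::finite" where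
  "dual_adjacency_matrix E x =
     (\<chi> y z. if y = z then of_nat CARD('x) * E 1 $ x $ z else 0)"

definition dual_idempotent ::
    "('x \<Rightarrow> 'x \<Rightarrow> bool) \<Rightarrow> 'x \<Rightarrow> nat \<Rightarrow> complex ^ 'x ^ 'x::finite" where
  "dual_idempotent adj x i = (\<chi> y z. if y = z \<and> gdist adj x z = i then 1 else 0)"

definition primary_module :: "('x \<Rightarrow> 'x \<Rightarrow> bool) \<Rightarrow> 'x \<Rightarrow> (complex ^ 'x::finite) set" where
  "primary_module adj x = {B *v char_vec {x} | B. B \<in> bose_mesner adj}"


section \<open>Delsarte cliques\<close>

definition delsarte_clique :: "('x::finite \<Rightarrow> 'x \<Rightarrow> bool) \<Rightarrow> real \<Rightarrow> 'x set \<Rightarrow> bool" where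
  "delsarte_clique adj \<theta>\<^sub>d C \<longleftrightarrow>
     C \<noteq> {} \<and> (\<forall>y\<in>C. \<forall>z\<in>C. y \<noteq> z \<longrightarrow> adj y z) \<and>
     real (card C) = 1 - real (valency adj) / \<theta>\<^sub>d"

definition dist_to_set :: "('x::finite \<Rightarrow> 'x \<Rightarrow> bool) \<Rightarrow> 'x \<Rightarrow> 'x set \<Rightarrow> nat" where
  "dist_to_set adj y C = Min (gdist adj y ` C)"

definition clique_cell :: "('x::finite \<Rightarrow> 'x \<Rightarrow> bool) \<Rightarrow> 'x set \<Rightarrow> nat \<Rightarrow> 'x set" where
  "clique_cell adj C i = {y. dist_to_set adj y C = i}"

definition cell_minus :: "('x::finite \<Rightarrow> 'x \<Rightarrow> bool) \<Rightarrow> 'x set \<Rightarrow> 'x \<Rightarrow> nat \<Rightarrow> 'x set" where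
  "cell_minus adj C x i = clique_cell adj C i \<inter> sphere_at adj i x"

definition cell_plus :: "('x::finite \<Rightarrow> 'x \<Rightarrow> bool) \<Rightarrow> 'x set \<Rightarrow> 'x \<Rightarrow> nat \<Rightarrow> 'x set" where
  "cell_plus adj C x i = clique_cell adj C i \<inter> sphere_at adj (i + 1) x"

definition cell_basis ::
    "('x::finite \<Rightarrow> 'x \<Rightarrow> bool) \<Rightarrow> nat \<Rightarrow> 'x set \<Rightarrow> 'x \<Rightarrow> (complex ^ 'x) list" where
  "cell_basis adj d C x =
     concat (map (\<lambda>i. [char_vec (cell_minus adj C x i), char_vec (cell_plus adj C x i)]) [0..<d])"

definition W_space ::
    "('x::finite \<Rightarrow> 'x \<Rightarrow> bool) \<Rightarrow> nat \<Rightarrow> 'x set \<Rightarrow> 'x \<Rightarrow> (complex ^ 'x) set" where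
  "W_space adj d C x = vec.span (set (cell_basis adj d C x))"

definition represents ::
    "complex mat \<Rightarrow> (complex ^ 'x \<Rightarrow> complex ^ 'x) \<Rightarrow> (complex ^ 'x::finite) list \<Rightarrow> bool" where
  "represents N f w \<longleftrightarrow>
     N \<in> carrier_mat (length w) (length w) \<and>
     (\<forall>j<length w. f (w ! j) = (\<Sum>i<length w. N $$ (i, j) *s w ! i))"


section \<open>Leonard systems\<close>

text \<open>
  Endomorphisms of a subspace \<open>V\<close> are given by functions on the ambient space of which only
  the restriction to \<open>V\<close> matters.
\<close>

definition endo_on :: "(complex ^ 'x) set \<Rightarrow> (complex ^ 'x \<Rightarrow> complex ^ 'x::finite) \<Rightarrow> bool" where
  "endo_on V f \<longleftrightarrow>
     (\<forall>v\<in>V. f v \<in> V) \<and> (\<forall>u\<in>V. \<forall>v\<in>V. f (u + v) = f u + f v) \<and> (\<forall>c. \<forall>v\<in>V. f (c *s v) = c *s f v)"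

definition eigenvalues_on ::
    "(complex ^ 'x) set \<Rightarrow> (complex ^ 'x \<Rightarrow> complex ^ 'x::finite) \<Rightarrow> complex set" where
  "eigenvalues_on V f = {\<nu>. \<exists>v\<in>V. v \<noteq> 0 \<and> f v = \<nu> *s v}"

text \<open>
  For diagonalizable \<open>f\<close> these conditions determine \<open>p\<close> on \<open>V\<close> as the projection onto the
  \<open>\<nu>\<close>-eigenspace along the sum of the other eigenspaces.
\<close>

definition spectral_projection ::
    "(complex ^ 'x) set \<Rightarrow> (complex ^ 'x \<Rightarrow> complex ^ 'x) \<Rightarrow> complex \<Rightarrow>
     (complex ^ 'x \<Rightarrow> complex ^ 'x::finite) \<Rightarrow> bool" where
  "spectral_projection V f \<nu> p \<longleftrightarrow>
     endo_on V p \<and>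
     (\<forall>v\<in>V. f v = \<nu> *s v \<longrightarrow> p v = v) \<and>
     (\<forall>\<mu>. \<mu> \<noteq> \<nu> \<longrightarrow> (\<forall>v\<in>V. f v = \<mu> *s v \<longrightarrow> p v = 0))"

definition idempotent_ordering ::
    "(complex ^ 'x) set \<Rightarrow> nat \<Rightarrow> (complex ^ 'x \<Rightarrow> complex ^ 'x) \<Rightarrow>
     (nat \<Rightarrow> complex ^ 'x \<Rightarrow> complex ^ 'x::finite) \<Rightarrow> bool" where
  "idempotent_ordering V n f F \<longleftrightarrow>
     (\<exists>\<nu>. bij_betw \<nu> {0..n} (eigenvalues_on V f) \<and>
          (\<forall>i\<le>n. spectral_projection V f (\<nu> i) (F i)))"

definition irreducible_tridiagonal ::
    "(complex ^ 'x) set \<Rightarrow> nat \<Rightarrow> (complex ^ 'x \<Rightarrow> complex ^ 'x) \<Rightarrow>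
     (nat \<Rightarrow> complex ^ 'x \<Rightarrow> complex ^ 'x::finite) \<Rightarrow> bool" where
  "irreducible_tridiagonal V n g F \<longleftrightarrow>
     (\<forall>i\<le>n. \<forall>j\<le>n.
        (\<bar>int i - int j\<bar> > 1 \<longrightarrow> (\<forall>v\<in>V. F i (g (F j v)) = 0)) \<and>
        (\<bar>int i - int j\<bar> = 1 \<longrightarrow> (\<exists>v\<in>V. F i (g (F j v)) \<noteq> 0)))"

definition leonard_system ::
    "(complex ^ 'x) set \<Rightarrow> nat \<Rightarrow>
     (complex ^ 'x \<Rightarrow> complex ^ 'x) \<Rightarrow> (complex ^ 'x \<Rightarrow> complex ^ 'x) \<Rightarrow>
     (nat \<Rightarrow> complex ^ 'x \<Rightarrow> complex ^ 'x) \<Rightarrow>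
     (nat \<Rightarrow> complex ^ 'x \<Rightarrow> complex ^ 'x::finite) \<Rightarrow> bool" where
  "leonard_system V n B Bs F Fs \<longleftrightarrow>
     vec.subspace V \<and> vec.dim V = n + 1 \<and> endo_on V B \<and> endo_on V Bs \<and>
     card (eigenvalues_on V B) = n + 1 \<and> card (eigenvalues_on V Bs) = n + 1 \<and>
     idempotent_ordering V n B F \<and> idempotent_ordering V n Bs Fs \<and>
     irreducible_tridiagonal V n Bs F \<and> irreducible_tridiagonal V n B Fs"

definition eigenvalue_sequence ::
    "(complex ^ 'x) set \<Rightarrow> nat \<Rightarrow> (complex ^ 'x \<Rightarrow> complex ^ 'x) \<Rightarrow>
     (nat \<Rightarrow> complex ^ 'x \<Rightarrow> complex ^ 'x::finite) \<Rightarrow> (nat \<Rightarrow> complex) \<Rightarrow> bool" where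
  "eigenvalue_sequence V n f F \<theta> \<longleftrightarrow> (\<forall>i\<le>n. \<forall>v\<in>V. f (F i v) = \<theta> i *s F i v)"

definition ordered_basis :: "(complex ^ 'x) set \<Rightarrow> (complex ^ 'x::finite) list \<Rightarrow> bool" where
  "ordered_basis V w \<longleftrightarrow> distinct w \<and> vec.independent (set w) \<and> vec.span (set w) = V"

definition lower_bidiagonal :: "nat \<Rightarrow> (nat \<Rightarrow> complex) \<Rightarrow> complex mat" where
  "lower_bidiagonal n \<theta> =
     Matrix.mat (n + 1) (n + 1) (\<lambda>(i, j). if i = j then \<theta> i else if i = j + 1 then 1 else 0)"

definition upper_bidiagonal :: "nat \<Rightarrow> (nat \<Rightarrow> complex) \<Rightarrow> (nat \<Rightarrow> complex) \<Rightarrow> complex mat" where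
  "upper_bidiagonal n \<theta> \<phi> =
     Matrix.mat (n + 1) (n + 1) (\<lambda>(i, j). if i = j then \<theta> i else if j = i + 1 then \<phi> j else 0)"

definition first_split_sequence ::
    "(complex ^ 'x) set \<Rightarrow> nat \<Rightarrow>
     (complex ^ 'x \<Rightarrow> complex ^ 'x) \<Rightarrow> (complex ^ 'x \<Rightarrow> complex ^ 'x) \<Rightarrow>
     (nat \<Rightarrow> complex ^ 'x \<Rightarrow> complex ^ 'x) \<Rightarrow>
     (nat \<Rightarrow> complex ^ 'x \<Rightarrow> complex ^ 'x::finite) \<Rightarrow> (nat \<Rightarrow> complex) \<Rightarrow> bool" where
  "first_split_sequence V n B Bs F Fs \<phi> \<longleftrightarrow>
     (\<forall>i\<in>{1..n}. \<phi> i \<noteq> 0) \<and>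
     (\<exists>\<theta> \<theta>s w. eigenvalue_sequence V n B F \<theta> \<and> eigenvalue_sequence V n Bs Fs \<theta>s \<and>
        ordered_basis V w \<and>
        represents (lower_bidiagonal n \<theta>) B w \<and> represents (upper_bidiagonal n \<theta>s \<phi>) Bs w)"

text \<open>In \<open>leonard_parameter_array\<close>, \<open>\<phi>\<close> is the first and \<open>\<psi>\<close> the second split sequence.\<close>

definition leonard_parameter_array ::
    "(complex ^ 'x) set \<Rightarrow> nat \<Rightarrow>
     (complex ^ 'x \<Rightarrow> complex ^ 'x) \<Rightarrow> (complex ^ 'x \<Rightarrow> complex ^ 'x) \<Rightarrow>
     (nat \<Rightarrow> complex ^ 'x \<Rightarrow> complex ^ 'x) \<Rightarrow>
     (nat \<Rightarrow> complex ^ 'x \<Rightarrow> complex ^ 'x::finite) \<Rightarrow>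
     (nat \<Rightarrow> complex) \<Rightarrow> (nat \<Rightarrow> complex) \<Rightarrow> (nat \<Rightarrow> complex) \<Rightarrow> (nat \<Rightarrow> complex) \<Rightarrow> bool" where
  "leonard_parameter_array V n B Bs F Fs \<theta> \<theta>s \<phi> \<psi> \<longleftrightarrow>
     eigenvalue_sequence V n B F \<theta> \<and> eigenvalue_sequence V n Bs Fs \<theta>s \<and>
     first_split_sequence V n B Bs F Fs \<phi> \<and>
     first_split_sequence V n B Bs (\<lambda>i. F (n - i)) Fs \<psi>"


section \<open>The q-Racah type\<close>

definition q_Racah ::
    "nat \<Rightarrow> (nat \<Rightarrow> complex) \<Rightarrow> (nat \<Rightarrow> complex) \<Rightarrow> (nat \<Rightarrow> complex) \<Rightarrow> (nat \<Rightarrow> complex) \<Rightarrow>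
     complex \<Rightarrow> complex \<Rightarrow> complex \<Rightarrow> complex \<Rightarrow> complex \<Rightarrow> complex \<Rightarrow> complex \<Rightarrow> bool" where
  "q_Racah d \<theta> \<theta>s \<phi> \<psi> q h hs s ss r1 r2 \<longleftrightarrow>
     h \<noteq> 0 \<and> hs \<noteq> 0 \<and> s \<noteq> 0 \<and> ss \<noteq> 0 \<and> r1 \<noteq> 0 \<and> r2 \<noteq> 0 \<and>
     r1 * r2 = s * ss * q ^ (d + 1) \<and>
     (\<forall>i\<in>{1..d}. q ^ i \<noteq> 1 \<and> r1 * q ^ i \<noteq> 1 \<and> r2 * q ^ i \<noteq> 1 \<and>
        ss * q ^ i / r1 \<noteq> 1 \<and> ss * q ^ i / r2 \<noteq> 1) \<and>
     (\<forall>i\<in>{2..2 * d}. s * q ^ i \<noteq> 1 \<and> ss * q ^ i \<noteq> 1) \<and>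
     (\<forall>i\<le>d. \<theta> i = \<theta> 0 + h * (1 - q ^ i) * (1 - s * q ^ (i + 1)) * q powi (- int i)) \<and>
     (\<forall>i\<le>d. \<theta>s i = \<theta>s 0 + hs * (1 - q ^ i) * (1 - ss * q ^ (i + 1)) * q powi (- int i)) \<and>
     (\<forall>i\<in>{1..d}. \<phi> i = h * hs * q powi (1 - 2 * int i) * (1 - q ^ i) *
        (1 - q powi (int i - int d - 1)) * (1 - r1 * q ^ i) * (1 - r2 * q ^ i)) \<and>
     (\<forall>i\<in>{1..d}. \<psi> i = h * hs * q powi (1 - 2 * int i) * (1 - q ^ i) *
        (1 - q powi (int i - int d - 1)) * (r1 - ss * q ^ i) * (r2 - ss * q ^ i) / ss)"


section \<open>The algebra H\<close>

text \<open>
  \<open>T n\<close> and \<open>Ti n\<close> are letters for the generator \<open>t\<^sub>n\<close> and its inverse. The free algebra on the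
  eight letters is the monoid algebra of the free monoid; as \<open>Poly_Mapping\<close> provides monoid algebras
  of additively written (not necessarily commutative) monoids, concatenation of words is
  written \<open>+\<close>.
\<close>

datatype gen_index = G0 | G1 | G2 | G3

datatype hletter = T gen_index | Ti gen_index

datatype hword = Word (letters: "hletter list")

instantiation hword :: monoid_add
begin

definition zero_hword :: hword where "zero_hword = Word []"

definition plus_hword :: "hword \<Rightarrow> hword \<Rightarrow> hword" where
  "plus_hword u v = Word (letters u @ letters v)"

instance
  by standard (auto simp: zero_hword_def plus_hword_def)

end

type_synonym free_alg = "hword \<Rightarrow>\<^sub>0 complex"

definition letter_elt :: "hletter \<Rightarrow> free_alg" where
  "letter_elt l = Poly_Mapping.single (Word [l]) 1"

definition scalar_elt :: "complex \<Rightarrow> free_alg" where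
  "scalar_elt c = Poly_Mapping.single 0 c"

definition free_ring :: "free_alg ring" where
  "free_ring = \<lparr>carrier = UNIV, mult = (*), one = 1, zero = 0, add = (+)\<rparr>"

lemma ring_free_ring: "ring free_ring"
proof (rule ringI)
  show "abelian_group free_ring"
  proof (rule abelian_groupI)
    fix y assume "y \<in> carrier free_ring"
    then show "\<exists>z\<in>carrier free_ring. z \<oplus>\<^bsub>free_ring\<^esub> y = \<zero>\<^bsub>free_ring\<^esub>"
      by (intro bexI[of _ "- y"]) (auto simp: free_ring_def)
  qed (auto simp: free_ring_def algebra_simps)
  show "Group.monoid free_ring"
    by (rule Group.monoidI) (auto simp: free_ring_def algebra_simps)
qed (auto simp: free_ring_def algebra_simps)

text \<open>The parameter \<open>qh\<close> is the chosen square root of \<open>q\<close>.\<close>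

definition H_relators :: "complex \<Rightarrow> free_alg set" where
  "H_relators qh =
     {letter_elt (T n) * letter_elt (Ti n) - 1 | n. True} \<union>
     {letter_elt (Ti n) * letter_elt (T n) - 1 | n. True} \<union>
     {(letter_elt (T n) + letter_elt (Ti n)) * y - y * (letter_elt (T n) + letter_elt (Ti n))
        | n y. True} \<union>
     {letter_elt (T G0) * letter_elt (T G1) * letter_elt (T G2) * letter_elt (T G3)
        - scalar_elt (inverse qh)}"

definition H_ideal :: "complex \<Rightarrow> free_alg set" where
  "H_ideal qh = Idl\<^bsub>free_ring\<^esub> (H_relators qh)"

definition H_alg :: "complex \<Rightarrow> free_alg set ring" where
  "H_alg qh = free_ring Quot H_ideal qh"

lemma ring_H_alg: "ring (H_alg qh)"
  unfolding H_alg_def H_ideal_def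
  by (intro ideal.quotient_is_ring ring.genideal_ideal ring_free_ring) (simp add: free_ring_def)

definition H_class :: "complex \<Rightarrow> free_alg \<Rightarrow> free_alg set" where
  "H_class qh a = H_ideal qh +>\<^bsub>free_ring\<^esub> a"

definition H_gen :: "complex \<Rightarrow> gen_index \<Rightarrow> free_alg set" where
  "H_gen qh n = H_class qh (letter_elt (T n))"

text \<open>Unital left modules over the complex algebra \<open>H_alg qh\<close> carried by a complex subspace \<open>W\<close>.\<close>

definition H_module ::
    "complex \<Rightarrow> (complex ^ 'x) set \<Rightarrow> (free_alg set \<Rightarrow> complex ^ 'x \<Rightarrow> complex ^ 'x::finite) \<Rightarrow> bool"
  where
  "H_module qh W act \<longleftrightarrow>
     vec.subspace W \<and>
     (\<forall>a\<in>carrier (H_alg qh). endo_on W (act a)) \<and>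
     (\<forall>a\<in>carrier (H_alg qh). \<forall>b\<in>carrier (H_alg qh). \<forall>v\<in>W.
        act (a \<oplus>\<^bsub>H_alg qh\<^esub> b) v = act a v + act b v \<and>
        act (a \<otimes>\<^bsub>H_alg qh\<^esub> b) v = act a (act b v)) \<and>
     (\<forall>c. \<forall>v\<in>W. act (H_class qh (scalar_elt c)) v = c *s v)"

definition H_submodule ::
    "complex \<Rightarrow> (complex ^ 'x) set \<Rightarrow> (free_alg set \<Rightarrow> complex ^ 'x \<Rightarrow> complex ^ 'x::finite) \<Rightarrow>
     (complex ^ 'x) set \<Rightarrow> bool" where
  "H_submodule qh W act U \<longleftrightarrow>
     vec.subspace U \<and> U \<subseteq> W \<and> (\<forall>a\<in>carrier (H_alg qh). \<forall>u\<in>U. act a u \<in> U)"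

definition irreducible_H_module ::
    "complex \<Rightarrow> (complex ^ 'x) set \<Rightarrow> (free_alg set \<Rightarrow> complex ^ 'x \<Rightarrow> complex ^ 'x::finite) \<Rightarrow> bool"
  where
  "irreducible_H_module qh W act \<longleftrightarrow>
     H_module qh W act \<and> W \<noteq> {0} \<and> (\<forall>U. H_submodule qh W act U \<longrightarrow> U = {0} \<or> U = W)"


section \<open>The matrices of the generators\<close>

text \<open>
  Throughout, \<open>ss\<close> stands for \<open>s\<^sup>*\<close>, and \<open>qh\<close>, \<open>ssh\<close>, \<open>r1h\<close>, \<open>r2h\<close> for the chosen square roots
  of \<open>q\<close>, \<open>s\<^sup>*\<close>, \<open>r\<^sub>1\<close>, \<open>r\<^sub>2\<close>; half-integral powers of \<open>q\<close> are powers of \<open>qh\<close>.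
\<close>

context
  fixes d :: nat and q ss r1 r2 qh ssh r1h r2h :: complex
begin

definition P_coeff :: "nat \<Rightarrow> complex" where
  "P_coeff i = (r1 - ss * q ^ (i + 1)) * (r2 - ss * q ^ (i + 1)) / (1 - ss * q ^ (2 * i + 2))"

definition R_coeff :: "nat \<Rightarrow> complex" where
  "R_coeff i = (1 - r1 * q ^ (i + 1)) * (1 - r2 * q ^ (i + 1)) / (1 - ss * q ^ (2 * i + 2))"

definition U_coeff :: "nat \<Rightarrow> complex" where
  "U_coeff i = (1 - q powi (int i - int d)) * (1 - ss * q ^ (i + 1)) / (1 - ss * q ^ (2 * i + 1))"

definition V_coeff :: "nat \<Rightarrow> complex" where
  "V_coeff i = (1 - q ^ i) * (1 - ss * q ^ (d + i + 1)) / (1 - ss * q ^ (2 * i + 1))"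

definition Z_coeff :: "nat \<Rightarrow> complex" where
  "Z_coeff i = (1 - q ^ i) * (1 - q powi (int i - int d)) / (1 - ss * q ^ (2 * i + 1))"

definition t0_block :: "nat \<Rightarrow> complex mat" where
  "t0_block i = (let \<sigma> = ssh; \<rho> = r1h * r2h; P = P_coeff i; R = R_coeff i in
     mat_of_rows_list 2
       [[(P + ss) / (\<sigma> * \<rho>), - (\<sigma> / \<rho>) * R],
        [P / (\<sigma> * \<rho>), (\<sigma> / \<rho>) * (1 - R)]])"

definition t3_block :: "nat \<Rightarrow> complex mat" where
  "t3_block i = (let \<rho> = r1h * r2h; P = P_coeff i; R = R_coeff i in
     mat_of_rows_list 2
       [[(1 - R) / (q ^ (i + 1) * \<rho>), R / (q ^ (i + 1) * \<rho>)],
        [- (q ^ (i + 1) / \<rho>) * P, (q ^ (i + 1) / \<rho>) * (P + ss)]])"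

definition t1_block :: "nat \<Rightarrow> complex mat" where
  "t1_block i = (let U = U_coeff i; V = V_coeff i in
     if i = 0 \<or> i = d then mat_of_rows_list 1 [[inverse (qh ^ d)]]
     else mat_of_rows_list 2
       [[qh ^ d * U + inverse (qh ^ d), - (qh ^ d) * U],
        [inverse (qh ^ d) * V, inverse (qh ^ d) * (1 - V)]])"

definition t2_block :: "nat \<Rightarrow> complex mat" where
  "t2_block i = (let \<kappa> = ssh * qh ^ (d + 1); U = U_coeff i; V = V_coeff i; Z = Z_coeff i in
     if i = 0 then mat_of_rows_list 1 [[\<kappa>]]
     else if i = d then mat_of_rows_list 1 [[inverse \<kappa>]]
     else mat_of_rows_list 2
       [[(\<kappa>\<^sup>2 * Z + 1) / \<kappa>, q ^ i * \<kappa> * U],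
        [- (V / (q ^ i * \<kappa>)), \<kappa> * (1 - Z)]])"

fun gen_matrix :: "gen_index \<Rightarrow> complex mat" where
  "gen_matrix G0 = diag_block_mat (map t0_block [0..<d])"
| "gen_matrix G1 = diag_block_mat (map t1_block [0..<d + 1])"
| "gen_matrix G2 = diag_block_mat (map t2_block [0..<d + 1])"
| "gen_matrix G3 = diag_block_mat (map t3_block [0..<d])"

end

end

theory Submission
  imports Defs
begin

text \<open>
  The relation \<open>t\<^sub>0 t\<^sub>1 t\<^sub>2 t\<^sub>3 = q\<^sup>-\<^sup>1\<^sup>/\<^sup>2\<close> makes \<open>t\<^sub>3 t\<^sub>0\<close> a scalar multiple of the inverse of \<open>t\<^sub>1 t\<^sub>2\<close>.
  The former preserves the spans of the pairs \<open>{C\<^sub>i\<^sup>-, C\<^sub>i\<^sup>+}\<close>, the latter the spans of the pairs \<open>{C\<^sub>i\<^sub>-\<^sub>1\<^sup>+, C\<^sub>i\<^sup>-}\<close>, so \<open>t\<^sub>3 t\<^sub>0\<close> is diagonal with respect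
  to the given basis. Multiplying the blocks gives the eigenvalues directly: they are
  \<open>(\<sigma> q\<^sup>i\<^sup>+\<^sup>1)\<^sup>-\<^sup>1\<close> on \<open>C\<^sub>i\<^sup>-\<close> and \<open>\<sigma> q\<^sup>i\<^sup>+\<^sup>1\<close> on \<open>C\<^sub>i\<^sup>+\<close>, where \<open>\<sigma>\<^sup>2 = s\<^sup>*\<close>, and the inequalities in the
  \<open>q\<close>-Racah condition say that these \<open>2d\<close> numbers are distinct (lemma \<open>inj_on_t3_t0_eigenvalue\<close>).
  Hence a nonzero submodule \<open>U\<close> contains every eigencomponent of each of its elements
  (\<open>eigencomponents_in_invariant_subspace\<close>), and therefore some nonzero basis vector.

  By the same inequalities \<open>P\<^sub>i\<close>, \<open>R\<^sub>i\<close>, \<open>U\<^sub>i\<close>, \<open>V\<^sub>i\<close> do not vanish, so the off-diagonal entries of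
  all \<open>2 \<times> 2\<close> blocks of \<open>t\<^sub>0\<close> and \<open>t\<^sub>1\<close> are nonzero. Thus \<open>t\<^sub>0\<close> passes membership in \<open>U\<close> between
  \<open>C\<^sub>i\<^sup>-\<close> and \<open>C\<^sub>i\<^sup>+\<close>, and \<open>t\<^sub>1\<close> passes it between \<open>C\<^sub>i\<^sub>-\<^sub>1\<^sup>+\<close> and \<open>C\<^sub>i\<^sup>-\<close>; all basis vectors lie in \<open>U\<close>.
  The argument uses only that these vectors span \<open>W\<close>, not that they are independent.
\<close>

section \<open>Invariant subspaces\<close>

lemma endo_on_sum:
  assumes "vec.subspace W" "endo_on W f" "finite J" "\<And>j. j \<in> J \<Longrightarrow> v j \<in> W"
  shows "f (\<Sum>j\<in>J. v j) = (\<Sum>j\<in>J. f (v j))"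
  using assms(3,4)
proof (induction J)
  case empty
  have "0 \<in> W" using assms(1) by (rule vec.subspace_0)
  then have "f (0 *s 0) = 0 *s f 0" using assms(2) unfolding endo_on_def by blast
  then show ?case by simp
next
  case (insert k J)
  have "(\<Sum>j\<in>J. v j) \<in> W" using insert.prems by (intro vec.subspace_sum assms(1)) auto
  then have "f (v k + (\<Sum>j\<in>J. v j)) = f (v k) + f (\<Sum>j\<in>J. v j)"
    using insert.prems assms(2) unfolding endo_on_def by blast
  with insert show ?case by simp
qed

lemma eigencomponents_in_invariant_subspace:
  assumes W: "vec.subspace W" and f: "endo_on W f"
    and U: "vec.subspace U" "U \<subseteq> W" "\<And>u. u \<in> U \<Longrightarrow> f u \<in> U"
    and J: "finite J" "inj_on l J"
    and v: "\<And>j. j \<in> J \<Longrightarrow> v j \<in> W" "\<And>j. j \<in> J \<Longrightarrow> f (v j) = l j *s v j"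
    and u: "(\<Sum>j\<in>J. v j) \<in> U"
  shows "\<forall>j\<in>J. v j \<in> U"
  using J v u
proof (induction J arbitrary: v)
  case empty
  then show ?case by simp
next
  case (insert k J)
  \<comment> \<open>applying \<open>f - l k\<close> removes the component at \<open>k\<close> and rescales the others by nonzero factors\<close>
  let ?u = "\<Sum>j\<in>insert k J. v j"
  let ?v = "\<lambda>j. (l j - l k) *s v j"
  have "f ?u - l k *s ?u \<in> U"
    using insert.prems(4) U by (intro vec.subspace_diff vec.subspace_scale) auto
  moreover have "f ?u = (\<Sum>j\<in>insert k J. f (v j))"
    using insert.prems(2) insert.hyps(1) by (intro endo_on_sum[OF W f]) auto
  moreover have "\<dots> = (\<Sum>j\<in>insert k J. l j *s v j)"
    using insert.prems(3) by (intro sum.cong) auto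
  ultimately have "(\<Sum>j\<in>J. ?v j) \<in> U"
    using insert.hyps
    by (simp add: vec.scale_sum_right vec.scale_left_diff_distrib sum_subtractf vec.scale_right_distrib)
  moreover have "?v j \<in> W" if "j \<in> J" for j
    using that insert.prems(2) by (intro vec.subspace_scale W) auto
  moreover have "f (?v j) = l j *s ?v j" if "j \<in> J" for j
  proof -
    have "f (?v j) = (l j - l k) *s f (v j)"
      using that insert.prems(2) f unfolding endo_on_def by blast
    also have "f (v j) = l j *s v j" using that by (intro insert.prems(3)) simp
    also have "(l j - l k) *s (l j *s v j) = l j *s ?v j" by (rule vec.scale_left_commute)
    finally show ?thesis .
  qed
  ultimately have vU: "?v j \<in> U" if "j \<in> J" for j
    using insert.IH[of ?v] insert.prems(1) that by auto
  have J: "v j \<in> U" if "j \<in> J" for j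
  proof -
    have "l j - l k \<noteq> 0"
      using that insert.hyps(2) insert.prems(1) by (auto simp: inj_on_def)
    then have "v j = inverse (l j - l k) *s ?v j"
      by (simp only: vec.scale_scale left_inverse vec.scale_one simp_thms)
    then show ?thesis using vec.subspace_scale[OF U(1) vU[OF that]] by metis
  qed
  have "?u - (\<Sum>j\<in>J. v j) \<in> U"
    using J by (intro vec.subspace_diff[OF U(1) insert.prems(4)] vec.subspace_sum[OF U(1)]) auto
  then have "v k \<in> U" using insert.hyps by simp
  with J show ?case by auto
qed

text \<open>
  The list \<open>w\<close> need not be independent: writing a nonzero vector of \<open>U\<close> as a combination of \<open>w\<close>,
  some term of it is nonzero, and this term is an eigencomponent.
\<close>

lemma eigenvector_list_meets_invariant_subspace:
  fixes w :: "(complex ^ 'x::finite) list"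
  assumes f: "endo_on (vec.span (set w)) f"
    and U: "vec.subspace U" "U \<subseteq> vec.span (set w)" "\<And>u. u \<in> U \<Longrightarrow> f u \<in> U" "U \<noteq> {0}"
    and l: "inj_on l {..<length w}" "\<And>j. j < length w \<Longrightarrow> f (w ! j) = l j *s w ! j"
  shows "\<exists>j<length w. w ! j \<in> U"
proof -
  let ?W = "vec.span (set w)"
  have W: "vec.subspace ?W" by simp
  have wW: "w ! j \<in> ?W" if "j < length w" for j
    using that by (intro vec.span_base) simp
  obtain u where u: "u \<in> U" "u \<noteq> 0"
    using U(1,4) vec.subspace_0 by blast
  have "\<exists>a. v = (\<Sum>j<length w. a j *s w ! j)" if "v \<in> ?W" for v
    using that
  proof (induction rule: vec.span_induct_alt)
    case base
    show ?case by (intro exI[of _ "\<lambda>_. 0"]) simp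
  next
    case (step c y v)
    then obtain a k where a: "v = (\<Sum>j<length w. a j *s w ! j)" and k: "k < length w" "y = w ! k"
      by (auto simp: in_set_conv_nth)
    have "c *s y + v = (\<Sum>j<length w. ((if j = k then c else 0) + a j) *s w ! j)"
      using k(1) by (simp add: a k(2) vec.scale_left_distrib sum.distrib if_distrib[of "\<lambda>b. b *s _"]
          sum.delta cong: if_cong)
    then show ?case by (intro exI[of _ "\<lambda>j. (if j = k then c else 0) + a j"])
  qed
  then obtain a where a: "u = (\<Sum>j<length w. a j *s w ! j)" using u(1) U(2) by blast
  have fa: "f (a j *s w ! j) = l j *s (a j *s w ! j)" if "j < length w" for j
  proof -
    have "f (a j *s w ! j) = a j *s f (w ! j)"
      using wW[OF that] f unfolding endo_on_def by blast
    then show ?thesis using l(2)[OF that] by (simp add: mult.commute)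
  qed
  have "\<forall>j\<in>{..<length w}. a j *s w ! j \<in> U"
    using U(1-3) l(1) fa u(1) wW
    by (intro eigencomponents_in_invariant_subspace[OF W f, where l = l])
       (auto simp: a intro: vec.subspace_scale[OF W])
  moreover obtain j where j: "j < length w" "a j *s w ! j \<noteq> 0"
    using u(2) unfolding a by (meson lessThan_iff sum.neutral)
  ultimately have "inverse (a j) *s (a j *s w ! j) \<in> U"
    using U(1) by (blast intro: vec.subspace_scale)
  moreover have "inverse (a j) *s (a j *s w ! j) = w ! j" using j(2) by simp
  ultimately show ?thesis using j(1) by metis
qed

lemma adjacent_closed_imp_all:
  assumes "\<And>j. Suc j < n \<Longrightarrow> P j \<longleftrightarrow> P (Suc j)" "j < n" "P j" "k < n"
  shows "P k"
proof -
  have "P j \<longleftrightarrow> P 0" if "j < n" for j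
    using that by (induction j) (auto simp: assms(1)[symmetric])
  with assms(2-4) show ?thesis by blast
qed


section \<open>Block diagonal matrices\<close>

lemma index_diag_block_mat_append:
  assumes "b < dim_col B" "i < dim_row (diag_block_mat (As @ B # Cs))"
  shows "diag_block_mat (As @ B # Cs) $$ (i, sum_list (map dim_col As) + b) =
    (if sum_list (map dim_row As) \<le> i \<and> i < sum_list (map dim_row As) + dim_row B
     then B $$ (i - sum_list (map dim_row As), b) else 0)"
  using assms(2)
proof (induction As arbitrary: i)
  case Nil
  then show ?case using assms(1)
    by (auto simp: Let_def dim_diag_block_mat)
next
  case (Cons A As)
  have c: "sum_list (map dim_col As) + b < dim_col (diag_block_mat (As @ B # Cs))"
    using assms(1) by (simp add: dim_diag_block_mat)
  show ?case
  proof (cases "i < dim_row A")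
    case True
    then show ?thesis using c Cons.prems by (auto simp: Let_def)
  next
    case False
    then have "i - dim_row A < dim_row (diag_block_mat (As @ B # Cs))"
      using Cons.prems by (auto simp: Let_def)
    from Cons.IH[OF this] show ?thesis using c Cons.prems False
      by (auto simp: Let_def add.assoc)
  qed
qed

lemma represents_diag_block_mat:
  fixes w :: "(complex ^ 'x::finite) list"
  assumes rep: "represents (diag_block_mat (As @ B # Cs)) f w"
    and n: "sum_list (map dim_row As) = n" "sum_list (map dim_col As) = n"
    and B: "dim_row B = m" "dim_col B = m" and b: "b < m"
  shows "f (w ! (n + b)) = (\<Sum>a<m. B $$ (a, b) *s w ! (n + a))"
proof -
  let ?N = "diag_block_mat (As @ B # Cs)"
  have dim: "dim_row ?N = length w" "dim_col ?N = length w"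
    using rep by (auto simp: represents_def)
  have m: "n + m \<le> length w"
    using dim(2) n B by (simp add: dim_diag_block_mat)
  have "f (w ! (n + b)) = (\<Sum>i<length w. ?N $$ (i, n + b) *s w ! i)"
    using rep m b by (auto simp: represents_def)
  also have "\<dots> = (\<Sum>i<length w. if n \<le> i \<and> i < n + m then B $$ (i - n, b) *s w ! i else 0)"
  proof (rule sum.cong)
    fix i assume "i \<in> {..<length w}"
    then have "?N $$ (i, n + b) = (if n \<le> i \<and> i < n + m then B $$ (i - n, b) else 0)"
      using index_diag_block_mat_append[of b B i As Cs] b B dim n by simp
    then show "?N $$ (i, n + b) *s w ! i =
        (if n \<le> i \<and> i < n + m then B $$ (i - n, b) *s w ! i else 0)"
      by simp
  qed simp
  also have "\<dots> = (\<Sum>i\<in>{n..<n + m}. B $$ (i - n, b) *s w ! i)"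
    using m by (intro sum.mono_neutral_cong_right) auto
  also have "\<dots> = (\<Sum>a<m. B $$ (a, b) *s w ! (n + a))"
    by (rule sum.reindex_bij_witness[of _ "\<lambda>a. n + a" "\<lambda>i. i - n"]) auto
  finally show ?thesis .
qed

lemma represents_diag_block_mat_2:
  fixes w :: "(complex ^ 'x::finite) list"
  assumes "represents (diag_block_mat (map g [l..<m])) f w" "l \<le> i" "i < m"
    and "(\<Sum>k\<leftarrow>[l..<i]. dim_row (g k)) = n" "(\<Sum>k\<leftarrow>[l..<i]. dim_col (g k)) = n"
    and "dim_row (g i) = 2" "dim_col (g i) = 2"
  shows "f (w ! n) = g i $$ (0, 0) *s w ! n + g i $$ (1, 0) *s w ! Suc n"
    and "f (w ! Suc n) = g i $$ (0, 1) *s w ! n + g i $$ (1, 1) *s w ! Suc n"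
proof -
  have "[l..<m] = [l..<i] @ i # [Suc i..<m]"
    using assms(2,3) upt_add_eq_append[of l i "m - i"] upt_conv_Cons[of i m] by simp
  with assms(1) have rep: "represents (diag_block_mat (map g [l..<i] @ g i # map g [Suc i..<m])) f w"
    by simp
  note * = represents_diag_block_mat[OF rep, of n 2]
  show "f (w ! n) = g i $$ (0, 0) *s w ! n + g i $$ (1, 0) *s w ! Suc n"
    using *[of 0] assms(4-) by (simp add: comp_def numeral_2_eq_2)
  show "f (w ! Suc n) = g i $$ (0, 1) *s w ! n + g i $$ (1, 1) *s w ! Suc n"
    using *[of 1] assms(4-) by (simp add: comp_def numeral_2_eq_2)
qed


section \<open>The generators on consecutive basis vectors\<close>

text \<open>
  In the list of cells, \<open>C\<^sub>i\<^sup>-\<close> has position \<open>2i\<close> and \<open>C\<^sub>i\<^sup>+\<close> has position \<open>2i + 1\<close>.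
\<close>

lemma represents_t0:
  assumes "represents (gen_matrix d q ss r1 r2 qh ssh r1h r2h G0) f w" "i < d"
  defines "P \<equiv> P_coeff q ss r1 r2 i" and "R \<equiv> R_coeff q ss r1 r2 i" and "\<rho> \<equiv> r1h * r2h"
  shows "f (w ! (2 * i)) = ((P + ss) / (ssh * \<rho>)) *s w ! (2 * i) + (P / (ssh * \<rho>)) *s w ! Suc (2 * i)"
    and "f (w ! Suc (2 * i)) = (- (ssh / \<rho>) * R) *s w ! (2 * i) + ((ssh / \<rho>) * (1 - R)) *s w ! Suc (2 * i)"
proof -
  let ?g = "t0_block q ss r1 r2 ssh r1h r2h"
  have dim: "dim_row (?g k) = 2" "dim_col (?g k) = 2" for k
    by (simp_all add: t0_block_def Let_def mat_of_rows_list_def)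
  have rep: "represents (diag_block_mat (map ?g [0..<d])) f w" using assms(1) by simp
  note * = represents_diag_block_mat_2[OF rep _ assms(2), of "2 * i"]
  show "f (w ! (2 * i)) = ((P + ss) / (ssh * \<rho>)) *s w ! (2 * i) + (P / (ssh * \<rho>)) *s w ! Suc (2 * i)"
    using *(1) dim
    by (simp add: t0_block_def Let_def mat_of_rows_list_def P_def R_def \<rho>_def sum_list_triv)
  show "f (w ! Suc (2 * i)) = (- (ssh / \<rho>) * R) *s w ! (2 * i) + ((ssh / \<rho>) * (1 - R)) *s w ! Suc (2 * i)"
    using *(2) dim
    by (simp add: t0_block_def Let_def mat_of_rows_list_def P_def R_def \<rho>_def sum_list_triv)
qed

lemma represents_t3:
  assumes "represents (gen_matrix d q ss r1 r2 qh ssh r1h r2h G3) f w" "i < d"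
  defines "P \<equiv> P_coeff q ss r1 r2 i" and "R \<equiv> R_coeff q ss r1 r2 i" and "\<rho> \<equiv> r1h * r2h"
  shows "f (w ! (2 * i)) =
      ((1 - R) / (q ^ (i + 1) * \<rho>)) *s w ! (2 * i) + (- (q ^ (i + 1) / \<rho>) * P) *s w ! Suc (2 * i)"
    and "f (w ! Suc (2 * i)) =
      (R / (q ^ (i + 1) * \<rho>)) *s w ! (2 * i) + ((q ^ (i + 1) / \<rho>) * (P + ss)) *s w ! Suc (2 * i)"
proof -
  let ?g = "t3_block q ss r1 r2 r1h r2h"
  have dim: "dim_row (?g k) = 2" "dim_col (?g k) = 2" for k
    by (simp_all add: t3_block_def Let_def mat_of_rows_list_def)
  have rep: "represents (diag_block_mat (map ?g [0..<d])) f w" using assms(1) by simp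
  note * = represents_diag_block_mat_2[OF rep _ assms(2), of "2 * i"]
  show "f (w ! (2 * i)) =
      ((1 - R) / (q ^ (i + 1) * \<rho>)) *s w ! (2 * i) + (- (q ^ (i + 1) / \<rho>) * P) *s w ! Suc (2 * i)"
    using *(1) dim
    by (simp add: t3_block_def Let_def mat_of_rows_list_def P_def R_def \<rho>_def sum_list_triv)
  show "f (w ! Suc (2 * i)) =
      (R / (q ^ (i + 1) * \<rho>)) *s w ! (2 * i) + ((q ^ (i + 1) / \<rho>) * (P + ss)) *s w ! Suc (2 * i)"
    using *(2) dim
    by (simp add: t3_block_def Let_def mat_of_rows_list_def P_def R_def \<rho>_def sum_list_triv)
qed

text \<open>
  The block of \<open>t\<^sub>1\<close> with index \<open>i\<close> starts at position \<open>2i - 1\<close>, as the block with index \<open>0\<close> has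
  size one; it acts on \<open>C\<^sub>i\<^sub>-\<^sub>1\<^sup>+\<close> and \<open>C\<^sub>i\<^sup>-\<close>. In the lemma the block index is \<open>Suc i\<close>.
\<close>

lemma represents_t1:
  assumes "represents (gen_matrix d q ss r1 r2 qh ssh r1h r2h G1) f w" "Suc i < d"
  defines "U \<equiv> U_coeff d q ss (Suc i)" and "V \<equiv> V_coeff d q ss (Suc i)"
  shows "f (w ! Suc (2 * i)) =
      (qh ^ d * U + inverse (qh ^ d)) *s w ! Suc (2 * i) + (inverse (qh ^ d) * V) *s w ! (2 * Suc i)"
    and "f (w ! (2 * Suc i)) =
      (- (qh ^ d) * U) *s w ! Suc (2 * i) + (inverse (qh ^ d) * (1 - V)) *s w ! (2 * Suc i)"
proof -
  let ?g = "t1_block d q ss qh"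
  have dim: "dim_row (?g k) = (if k = 0 \<or> k = d then 1 else 2)"
    "dim_col (?g k) = (if k = 0 \<or> k = d then 1 else 2)" for k
    by (simp_all add: t1_block_def Let_def mat_of_rows_list_def)
  have rep: "represents (diag_block_mat (map ?g [0..<d + 1])) f w"
    using assms(1) by (simp only: gen_matrix.simps)
  have "(\<Sum>k\<leftarrow>[0..<Suc i]. if k = 0 \<or> k = d then 1 else 2) = Suc (2 * i)"
    using assms(2) by (induction i) auto
  then have sums: "(\<Sum>k\<leftarrow>[0..<Suc i]. dim_row (?g k)) = Suc (2 * i)"
    "(\<Sum>k\<leftarrow>[0..<Suc i]. dim_col (?g k)) = Suc (2 * i)"
    by (simp_all only: dim)
  have B: "dim_row (?g (Suc i)) = 2" "dim_col (?g (Suc i)) = 2"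
    using assms(2) by (simp_all add: dim)
  have "Suc i < d + 1" using assms(2) by simp
  note * = represents_diag_block_mat_2[OF rep _ this sums B]
  show "f (w ! Suc (2 * i)) =
      (qh ^ d * U + inverse (qh ^ d)) *s w ! Suc (2 * i) + (inverse (qh ^ d) * V) *s w ! (2 * Suc i)"
    using *(1) assms(2)
    by (simp add: t1_block_def Let_def mat_of_rows_list_def U_def V_def)
  show "f (w ! (2 * Suc i)) =
      (- (qh ^ d) * U) *s w ! Suc (2 * i) + (inverse (qh ^ d) * (1 - V)) *s w ! (2 * Suc i)"
    using *(2) assms(2)
    by (simp add: t1_block_def Let_def mat_of_rows_list_def U_def V_def)
qed


section \<open>The eigenvalues of \<open>t\<^sub>3 t\<^sub>0\<close>\<close>

text \<open>The determinant identity \<open>P\<^sub>i + s\<^sup>* - s\<^sup>* R\<^sub>i = r\<^sub>1 r\<^sub>2\<close>: the blocks of \<open>t\<^sub>0\<close> have determinant \<open>1\<close>.\<close>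

lemma P_R_coeff_identity:
  assumes "ss * q ^ (2 * i + 2) \<noteq> 1"
  shows "P_coeff q ss r1 r2 i + ss - ss * R_coeff q ss r1 r2 i = r1 * r2"
proof -
  define Q where "Q = q ^ (i + 1)"
  have Q2: "q ^ (2 * i + 2) = Q * Q" by (simp add: Q_def mult_2 flip: power_add)
  have nz: "1 - ss * (Q * Q) \<noteq> 0" using assms unfolding Q2 by simp
  have "P_coeff q ss r1 r2 i + ss - ss * R_coeff q ss r1 r2 i =
      ((r1 - ss * Q) * (r2 - ss * Q) + ss * (1 - ss * (Q * Q)) - ss * ((1 - r1 * Q) * (1 - r2 * Q)))
        / (1 - ss * (Q * Q))"
    unfolding P_coeff_def R_coeff_def Q2 Q_def[symmetric] using nz
    by (simp add: add_divide_distrib diff_divide_distrib)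
  also have "\<dots> = (r1 * r2 * (1 - ss * (Q * Q))) / (1 - ss * (Q * Q))"
    by (simp add: algebra_simps)
  finally show ?thesis using nz by simp
qed

text \<open>
  The eigenvalue of \<open>t\<^sub>3 t\<^sub>0\<close> on the basis vector in position \<open>j\<close>, counted from \<open>0\<close>; the
  parameter \<open>\<sigma>\<close> is the chosen square root of \<open>s\<^sup>*\<close>.
\<close>

definition t3_t0_eigenvalue :: "complex \<Rightarrow> complex \<Rightarrow> nat \<Rightarrow> complex" where
  "t3_t0_eigenvalue q \<sigma> j =
     (if even j then inverse (\<sigma> * q ^ (j div 2 + 1)) else \<sigma> * q ^ (j div 2 + 1))"

lemma inj_on_t3_t0_eigenvalue:
  assumes "q \<noteq> 0" "\<sigma> \<noteq> 0"
    and q: "\<And>i. 1 \<le> i \<Longrightarrow> i \<le> d \<Longrightarrow> q ^ i \<noteq> 1"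
    and s: "\<And>i. 2 \<le> i \<Longrightarrow> i \<le> 2 * d \<Longrightarrow> \<sigma>\<^sup>2 * q ^ i \<noteq> 1"
  shows "inj_on (t3_t0_eigenvalue q \<sigma>) {..<2 * d}"
proof -
  have pow: "a = b" if "a \<le> d" "b \<le> d" "q ^ a = q ^ b" for a b
    using that
  proof (induction a b rule: linorder_wlog)
    case (le a b)
    have "q ^ b = q ^ a * q ^ (b - a)" using le(1) by (simp flip: power_add)
    then have "q ^ (b - a) = 1" using le(4) assms(1) by simp
    then show ?case using q[of "b - a"] le(1,3) by fastforce
  next
    case (sym a b)
    then show ?case by simp
  qed
  have cross: "\<sigma> * q ^ (a + 1) \<noteq> inverse (\<sigma> * q ^ (b + 1))" if "a < d" "b < d" for a b
  proof
    assume "\<sigma> * q ^ (a + 1) = inverse (\<sigma> * q ^ (b + 1))"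
    moreover have "\<sigma> * q ^ (b + 1) \<noteq> 0" using assms(1,2) by simp
    ultimately have "\<sigma> * q ^ (a + 1) * (\<sigma> * q ^ (b + 1)) = 1"
      by (metis left_inverse[of "\<sigma> * q ^ (b + 1)"])
    then have "\<sigma>\<^sup>2 * q ^ (a + b + 2) = 1"
      by (simp add: power2_eq_square power_add mult_ac)
    then show False using s[of "a + b + 2"] that by simp
  qed
  show ?thesis
  proof (rule inj_onI)
    fix j k assume j: "j \<in> {..<2 * d}" and k: "k \<in> {..<2 * d}"
      and eq: "t3_t0_eigenvalue q \<sigma> j = t3_t0_eigenvalue q \<sigma> k"
    have lt: "j div 2 < d" "k div 2 < d" using j k by auto
    have par: "even j \<longleftrightarrow> even k"
      using eq cross[OF lt] cross[OF lt(2,1)] by (auto simp: t3_t0_eigenvalue_def split: if_splits)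
    then have "q ^ (j div 2 + 1) = q ^ (k div 2 + 1)"
      using eq assms(2) by (auto simp: t3_t0_eigenvalue_def split: if_splits)
    then have "j div 2 = k div 2" using pow[of "j div 2 + 1" "k div 2 + 1"] lt by simp
    with par show "j = k" by (metis dvd_mult_div_cancel odd_two_times_div_two_succ)
  qed
qed


section \<open>Modules over the algebra\<close>

lemma H_gen_carrier: "H_gen qh n \<in> carrier (H_alg qh)"
  by (auto simp: H_gen_def H_class_def H_alg_def FactRing_def A_RCOSETS_def RCOSETS_def
      a_r_coset_def free_ring_def)

lemma length_cell_basis: "length (cell_basis adj d C x) = 2 * d"
  unfolding cell_basis_def by (induction d) auto

lemma gdist_refl: "gdist adj x x = 0"
  unfolding gdist_def by (rule Least_eq_0) simp

lemma char_vec_base_nonzero: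
  assumes "x \<in> C"
  shows "char_vec (cell_minus adj C x 0) \<noteq> 0"
proof -
  have "dist_to_set adj x C = 0"
    unfolding dist_to_set_def
    using assms by (intro Min_eqI) (auto intro!: image_eqI[of _ _ x] simp: gdist_refl)
  then have "x \<in> cell_minus adj C x 0"
    by (simp add: cell_minus_def clique_cell_def sphere_at_def gdist_refl)
  then have "char_vec (cell_minus adj C x 0) $ x \<noteq> 0" by (simp add: char_vec_def)
  then show ?thesis by (metis zero_index)
qed

lemma subspace_component:
  fixes u v :: "complex ^ 'x::finite"
  assumes U: "vec.subspace U" and uv: "a *s u + b *s v \<in> U"
  shows "u \<in> U \<Longrightarrow> b \<noteq> 0 \<Longrightarrow> v \<in> U" and "v \<in> U \<Longrightarrow> a \<noteq> 0 \<Longrightarrow> u \<in> U"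
proof -
  assume "u \<in> U" "b \<noteq> 0"
  then have "inverse b *s ((a *s u + b *s v) - a *s u) \<in> U"
    using U uv by (intro vec.subspace_scale vec.subspace_diff)
  then show "v \<in> U" using \<open>b \<noteq> 0\<close> by simp
next
  assume "v \<in> U" "a \<noteq> 0"
  then have "inverse a *s ((a *s u + b *s v) - b *s v) \<in> U"
    using U uv by (intro vec.subspace_scale vec.subspace_diff)
  then show "u \<in> U" using \<open>a \<noteq> 0\<close> by simp
qed

text \<open>
  Within one block the off-diagonal entries of the product of \<open>t\<^sub>3\<close> and \<open>t\<^sub>0\<close> cancel, and the diagonal
  ones are the multiples \<open>(\<sigma> q\<^sup>i\<^sup>+\<^sup>1)\<^sup>-\<^sup>1\<close> and \<open>\<sigma> q\<^sup>i\<^sup>+\<^sup>1\<close> of the determinant of the block of \<open>t\<^sub>0\<close>.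
\<close>

lemma t3_t0_eigenvector:
  assumes f0: "represents (gen_matrix d q ss r1 r2 qh ssh r1h r2h G0) f0 w"
    and f3: "represents (gen_matrix d q ss r1 r2 qh ssh r1h r2h G3) f3 w"
    and lin: "endo_on W f3" "set w \<subseteq> W" "vec.subspace W"
    and j: "j < 2 * d" "length w = 2 * d"
    and nz: "q \<noteq> 0" "ssh \<noteq> 0" "r1h \<noteq> 0" "r2h \<noteq> 0"
    and sq: "ssh\<^sup>2 = ss" "r1h\<^sup>2 = r1" "r2h\<^sup>2 = r2"
    and den: "\<And>i. i < d \<Longrightarrow> ss * q ^ (2 * i + 2) \<noteq> 1"
  shows "f3 (f0 (w ! j)) = t3_t0_eigenvalue q ssh j *s w ! j"
proof -
  define i where "i = j div 2"
  have i: "i < d" using j(1) by (auto simp: i_def)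
  define P R \<rho> Q where "P = P_coeff q ss r1 r2 i" and "R = R_coeff q ss r1 r2 i"
    and "\<rho> = r1h * r2h" and "Q = q ^ (i + 1)"
  have nz': "\<rho> \<noteq> 0" "Q \<noteq> 0" using nz by (auto simp: \<rho>_def Q_def)
  have "\<rho>\<^sup>2 = r1 * r2" by (simp add: \<rho>_def power_mult_distrib sq)
  then have det: "P + ssh\<^sup>2 - ssh\<^sup>2 * R = \<rho>\<^sup>2"
    using P_R_coeff_identity[OF den[OF i], of r1 r2] by (simp add: P_def R_def sq)
  have mem: "w ! (2 * i) \<in> W" "w ! Suc (2 * i) \<in> W"
    using lin(2) i j(2) by (auto intro!: subsetD[OF lin(2)] nth_mem)
  have f3_lin: "f3 (a *s w ! (2 * i) + b *s w ! Suc (2 * i)) =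
      a *s f3 (w ! (2 * i)) + b *s f3 (w ! Suc (2 * i))" for a b
    using lin(1) mem vec.subspace_scale[OF lin(3)] unfolding endo_on_def by metis
  note t0 = represents_t0[OF f0 i, folded P_def R_def \<rho>_def]
  note t3 = represents_t3[OF f3 i, folded P_def R_def \<rho>_def Q_def]
  have regroup: "a *s (b *s u + c *s v) + a' *s (b' *s u + c' *s v) =
      (a * b + a' * b') *s u + (a * c + a' * c') *s v" for a b c a' b' c' and u v :: "complex ^ 'a"
    by (simp add: vec.scale_right_distrib vec.scale_left_distrib)
  have "f3 (f0 (w ! (2 * i))) = inverse (ssh * Q) *s w ! (2 * i)"
  proof -
    have "(P + ss) / (ssh * \<rho>) * ((1 - R) / (Q * \<rho>)) + P / (ssh * \<rho>) * (R / (Q * \<rho>)) =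
        (P + ssh\<^sup>2 - ssh\<^sup>2 * R) / (\<rho>\<^sup>2 * (ssh * Q))"
      using nz' nz(2) by (simp add: sq(1)[symmetric] field_simps power2_eq_square)
    also have "\<dots> = inverse (ssh * Q)"
      unfolding det using nz' by (simp add: divide_inverse)
    finally have A: "(P + ss) / (ssh * \<rho>) * ((1 - R) / (Q * \<rho>)) + P / (ssh * \<rho>) * (R / (Q * \<rho>)) =
      inverse (ssh * Q)" .
    have B: "(P + ss) / (ssh * \<rho>) * (- (Q / \<rho>) * P) + P / (ssh * \<rho>) * ((Q / \<rho>) * (P + ss)) = 0"
      using nz' nz(2) by (simp add: field_simps)
    show ?thesis unfolding t0(1) f3_lin t3 regroup A B by simp
  qed
  moreover have "f3 (f0 (w ! Suc (2 * i))) = (ssh * Q) *s w ! Suc (2 * i)"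
  proof -
    have A: "(- (ssh / \<rho>) * R) * ((1 - R) / (Q * \<rho>)) + ((ssh / \<rho>) * (1 - R)) * (R / (Q * \<rho>)) = 0"
      using nz' by (simp add: field_simps)
    have "(- (ssh / \<rho>) * R) * (- (Q / \<rho>) * P) + ((ssh / \<rho>) * (1 - R)) * ((Q / \<rho>) * (P + ss)) =
        (P + ssh\<^sup>2 - ssh\<^sup>2 * R) * (ssh * Q) / \<rho>\<^sup>2"
      using nz' by (simp add: sq(1)[symmetric] field_simps power2_eq_square)
    also have "\<dots> = ssh * Q"
      unfolding det using nz' by simp
    finally have B: "(- (ssh / \<rho>) * R) * (- (Q / \<rho>) * P) + ((ssh / \<rho>) * (1 - R)) * ((Q / \<rho>) * (P + ss)) =
        ssh * Q" .
    show ?thesis unfolding t0(2) f3_lin t3 regroup A B by simp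
  qed
  ultimately show ?thesis
    by (cases "even j") (auto simp: t3_t0_eigenvalue_def i_def Q_def)
qed


section \<open>Irreducibility\<close>

theorem corollary12p13:
  fixes adj :: "'x::finite \<Rightarrow> 'x \<Rightarrow> bool"
    and d :: nat
    and E :: "nat \<Rightarrow> complex ^ 'x ^ 'x"
    and \<theta> :: "nat \<Rightarrow> real"
    and \<theta>s \<phi> \<psi> :: "nat \<Rightarrow> complex"
    and C :: "'x set"
    and x :: 'x
    and q h hs s ss r1 r2 qh sh ssh r1h r2h :: complex
    and act :: "free_alg set \<Rightarrow> complex ^ 'x \<Rightarrow> complex ^ 'x"
  assumes graph: "connected_simple_graph adj"
    and diam: "d = graph_diameter adj" "3 \<le> d"
    and dr: "distance_regular adj"
    and qpoly: "Q_polynomial adj d E"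
    and eigenvalues: "adjacency_matrix adj = (\<Sum>i\<le>d. mscale (complex_of_real (\<theta> i)) (E i))"
    and decreasing: "\<And>i j. i < j \<Longrightarrow> j \<le> d \<Longrightarrow> \<theta> j < \<theta> i"
    and clique: "delsarte_clique adj (\<theta> d) C"
    and base: "x \<in> C"
    and dual_eigenvalues:
      "dual_adjacency_matrix E x = (\<Sum>i\<le>d. mscale (\<theta>s i) (dual_idempotent adj x i))"
    and leonard:
      "leonard_system (primary_module adj x) d
         ((*v) (adjacency_matrix adj)) ((*v) (dual_adjacency_matrix E x))
         (\<lambda>i. (*v) (E i)) (\<lambda>i. (*v) (dual_idempotent adj x i))"
    and parameter_array:
      "leonard_parameter_array (primary_module adj x) d
         ((*v) (adjacency_matrix adj)) ((*v) (dual_adjacency_matrix E x))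
         (\<lambda>i. (*v) (E i)) (\<lambda>i. (*v) (dual_idempotent adj x i))
         (\<lambda>i. complex_of_real (\<theta> i)) \<theta>s \<phi> \<psi>"
    and q: "q \<noteq> 0" "q\<^sup>2 \<noteq> 1"
    and racah: "q_Racah d (\<lambda>i. complex_of_real (\<theta> i)) \<theta>s \<phi> \<psi> q h hs s ss r1 r2"
    and roots: "qh\<^sup>2 = q" "sh\<^sup>2 = s" "ssh\<^sup>2 = ss" "r1h\<^sup>2 = r1" "r2h\<^sup>2 = r2"
      "r1h * r2h = sh * ssh * qh ^ (d + 1)"
    and module_structure: "H_module qh (W_space adj d C x) act"
    and generators: "\<And>n. represents (gen_matrix d q ss r1 r2 qh ssh r1h r2h n)
                            (act (H_gen qh n)) (cell_basis adj d C x)"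
  shows "irreducible_H_module qh (W_space adj d C x) act"
proof -
  let ?w = "cell_basis adj d C x" and ?W = "W_space adj d C x"
  let ?t = "\<lambda>n. act (H_gen qh n)"
  let ?P = "P_coeff q ss r1 r2" and ?R = "R_coeff q ss r1 r2"
    and ?U = "U_coeff d q ss" and ?V = "V_coeff d q ss"
  have W: "vec.subspace ?W" "set ?w \<subseteq> ?W" "?W = vec.span (set ?w)"
    by (auto simp: W_space_def intro: vec.span_base)
  have len: "length ?w = 2 * d" by (rule length_cell_basis)
  have endo: "endo_on ?W (?t n)" for n
    using module_structure H_gen_carrier unfolding H_module_def by blast
  have param: "ss \<noteq> 0" "r1 \<noteq> 0" "r2 \<noteq> 0" using racah by (auto simp: q_Racah_def)
  have q_ne: "q ^ i \<noteq> 1" and r_ne: "r1 * q ^ i \<noteq> 1" "r2 * q ^ i \<noteq> 1"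
    and sr_ne: "ss * q ^ i / r1 \<noteq> 1" "ss * q ^ i / r2 \<noteq> 1" if "1 \<le> i" "i \<le> d" for i
    using racah that by (auto simp: q_Racah_def)
  have s_ne: "ss * q ^ i \<noteq> 1" if "2 \<le> i" "i \<le> 2 * d" for i
    using racah that by (auto simp: q_Racah_def)
  have root_ne: "qh \<noteq> 0" "ssh \<noteq> 0" "r1h \<noteq> 0" "r2h \<noteq> 0" using roots param q by auto

  have P: "?P i \<noteq> 0" and R: "?R i \<noteq> 0" if "i < d" for i
    using that r_ne[of "i + 1"] sr_ne[of "i + 1"] s_ne[of "2 * i + 2"] param
    by (auto simp: P_coeff_def R_coeff_def)
  have Uc: "?U i \<noteq> 0" and Vc: "?V i \<noteq> 0" if "1 \<le> i" "i < d" for i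
  proof -
    have "q powi (int i - int d) = inverse (q ^ (d - i))"
      using that by (simp add: power_int_def nat_diff_distrib' power_inverse)
    moreover have "q ^ (d - i) \<noteq> 1" using q_ne[of "d - i"] that by simp
    ultimately have "q powi (int i - int d) \<noteq> 1" by (metis inverse_eq_1_iff)
    then show "?U i \<noteq> 0" "?V i \<noteq> 0"
      using that q_ne[of i] s_ne[of "i + 1"] s_ne[of "2 * i + 1"] s_ne[of "d + i + 1"]
      by (auto simp: U_coeff_def V_coeff_def)
  qed

  have "U = {0} \<or> U = ?W" if sub: "H_submodule qh ?W act U" for U
  proof (rule disjCI)
    assume "U \<noteq> ?W"
    show "U = {0}"
    proof (rule ccontr)
      assume ne: "U \<noteq> {0}"
      have inv: "?t n u \<in> U" if "u \<in> U" for n u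
        using sub that H_gen_carrier by (auto simp: H_submodule_def)
      have U: "vec.subspace U" "U \<subseteq> ?W" using sub by (auto simp: H_submodule_def)
      let ?f = "\<lambda>v. ?t G3 (?t G0 v)"
      have "endo_on ?W ?f" using endo[of G0] endo[of G3] by (auto simp: endo_on_def)
      moreover have "?f (?w ! j) = t3_t0_eigenvalue q ssh j *s ?w ! j" if "j < length ?w" for j
      proof (rule t3_t0_eigenvector[OF generators generators endo W(2,1) _ len q(1) root_ne(2-4) roots(3-5)])
        show "ss * q ^ (2 * i + 2) \<noteq> 1" if "i < d" for i
          using that by (intro s_ne) auto
      qed (use that len in simp)
      moreover have "inj_on (t3_t0_eigenvalue q ssh) {..<length ?w}"
        using q_ne s_ne q(1) root_ne(2) roots(3) unfolding len
        by (intro inj_on_t3_t0_eigenvalue) auto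
      ultimately obtain j where j: "j < 2 * d" "?w ! j \<in> U"
        using eigenvector_list_meets_invariant_subspace[of ?w ?f U "t3_t0_eigenvalue q ssh"]
          U ne inv len W(3) by auto
      have pair: "?w ! (2 * i) \<in> U \<longleftrightarrow> ?w ! Suc (2 * i) \<in> U" if "i < d" for i
      proof
        note t0 = represents_t0[OF generators that]
        show "?w ! Suc (2 * i) \<in> U" if *: "?w ! (2 * i) \<in> U"
          by (rule subspace_component(1)[OF U(1) inv[OF *, of G0, unfolded t0(1)] *])
             (use P[OF \<open>i < d\<close>] root_ne in auto)
        show "?w ! (2 * i) \<in> U" if *: "?w ! Suc (2 * i) \<in> U"
          by (rule subspace_component(2)[OF U(1) inv[OF *, of G0, unfolded t0(2)] *])
             (use R[OF \<open>i < d\<close>] root_ne in auto)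
      qed
      have link: "?w ! Suc (2 * i) \<in> U \<longleftrightarrow> ?w ! (2 * Suc i) \<in> U" if "Suc i < d" for i
      proof
        note t1 = represents_t1[OF generators that]
        show "?w ! (2 * Suc i) \<in> U" if *: "?w ! Suc (2 * i) \<in> U"
          by (rule subspace_component(1)[OF U(1) inv[OF *, of G1, unfolded t1(1)] *])
             (use Vc[of "Suc i"] \<open>Suc i < d\<close> root_ne in auto)
        show "?w ! Suc (2 * i) \<in> U" if *: "?w ! (2 * Suc i) \<in> U"
          by (rule subspace_component(2)[OF U(1) inv[OF *, of G1, unfolded t1(2)] *])
             (use Uc[of "Suc i"] \<open>Suc i < d\<close> root_ne in auto)
      qed
      have step: "?w ! j \<in> U \<longleftrightarrow> ?w ! Suc j \<in> U" if "Suc j < 2 * d" for j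
      proof (cases "even j")
        case True
        then show ?thesis using that pair by (auto elim!: evenE)
      next
        case False
        then show ?thesis using that link by (auto elim!: oddE)
      qed
      have "?w ! k \<in> U" if "k < 2 * d" for k
        by (rule adjacent_closed_imp_all[of "2 * d" "\<lambda>j. ?w ! j \<in> U", OF step j that])
      then have "set ?w \<subseteq> U" using len by (auto simp: in_set_conv_nth)
      then have "?W \<subseteq> U" unfolding W(3) using U(1) by (rule vec.span_minimal)
      with U(2) \<open>U \<noteq> ?W\<close> show False by blast
    qed
  qed
  moreover have "?W \<noteq> {0}"
  proof -
    have "char_vec (cell_minus adj C x 0) \<in> set ?w"
      using diam(2) by (auto simp: cell_basis_def)
    then show ?thesis using W(2) char_vec_base_nonzero[OF base, of adj] by blast
  qed
  ultimately show ?thesis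
    using module_structure unfolding irreducible_H_module_def by blast
qed

end
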